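(* Let $\Gamma \cup \{\varphi\}$ be a set of formulas over $\Sigma_\omega=\{\land,\vee,\to,\neg\}$. The following assertions are equivalent: (1) $\Gamma \vdash_{C_\omega} \varphi$; (2) $\Gamma \models_{\mathbb{HC}_\omega} \varphi$; (3) $\Gamma \models_{C_\omega}^{HSW} \varphi$.
   Context: Formulas: $For(\Sigma_\omega)$ is the free algebra over the signature $\Sigma_\omega=\{\land,\vee,\to,\neg\}$ ($\land,\vee,\to$ binary, $\neg$ unary) generated by denumerably many propositional variables $p_0,p_1,\dots$. Logic $C_\omega$: $\Gamma\vdash_{C_\omega}\varphi$ denotes derivability from $\Gamma$ in the Hilbert calculus with the single rule modus ponens (from $\alpha$ and $\alpha\to\beta$ infer $\beta$) and the axiom schemas: $\alpha\to(\beta\to\alpha)$; $(\alpha\to(\beta\to\gamma))\to((\alpha\to\beta)\to(\alpha\to\gamma))$; $\alpha\to(\beta\to(\alpha\land\beta))$; $(\alpha\land\beta)\to\alpha$; $(\alpha\land\beta)\to\beta$; $\alpha\to(\alpha\vee\beta)$; $\beta\to(\alpha\vee\beta)$; $(\alpha\to\gamma)\to((\beta\to\gamma)\to((\alpha\vee\beta)\to\gamma))$; $\alpha\vee\neg\alpha$; $\neg\neg\alpha\to\alpha$. Prosets: a proset is a non-empty set $P$ with a reflexive transitive relation $\preceq$. Write $x\equiv y$ if $x\preceq y$ and $y\preceq x$. For $A,B\subseteq P$: $A\preceq B$ means $a\preceq b$ for all $a\in A,b\in B$ (similarly with an element in place of a set); $A\equiv B$ means $a\equiv b$ for all $a\in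 A,b\in B$. $\mathsf{Min}(B)=\{x\in B: x\preceq B\}$, $\mathsf{Max}(B)=\{x\in B: B\preceq x\}$; $\mathsf{Ub}(B)$, $\mathsf{Lb}(B)$ are the sets of upper and lower bounds of $B$ in $P$; $\top=\mathsf{Max}(P)$. Hyperoperations: an $n$-ary hyperoperation on $A$ is a map $A^n\to\wp(A)\setminus\{\emptyset\}$; a hyperalgebra over a signature is a set with a hyperoperation for each symbol. Hyperoperations are extended to non-empty subsets by taking unions. Hyperlattice: a proset in which $x\curlyvee y:=\mathsf{Min}(\mathsf{Ub}(\{x,y\}))$ and $x\curlywedge y:=\mathsf{Max}(\mathsf{Lb}(\{x,y\}))$ are non-empty for all $x,y$. A Sette implicative hyperlattice (IHL) is a hyperalgebra $\mathsf L=\langle L,\curlywedge,\curlyvee,\multimap\rangle$ such that $\langle L,\curlywedge,\curlyvee\rangle$ is a hyperlattice and, for all $x,y,z,z'$: $z\in x\multimap y$ implies $x\curlywedge z\preceq y$; $x\curlywedge z\preceq y$ implies $z\preceq x\multimap y$; $z\equiv z'$ and $z\in x\multimap y$ imply $z'\in x\multimap y$. HC$_\omega$A (hyper $C_\omega$ algebra): a hyperalgebra $\mathsf H=\langle H,\curlywedge,\curlyvee,\multimap,\div\rangle$ over $\Sigma_\omega$ (with $\land,\vee,\to,\neg$ interpreted as $\curlywedge,\curlyvee,\multimap,\div$) whose reduct $\langle H,\curlywedge,\curlyvee,\multimap\rangle$ is an IHL and such that for all $x,y,w$: if $y\in\div x$ and $w\in x\curlyvee y$ then $w\in\top$; if $y\in\div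 x$ and $w\in\div y$ then $w\preceq x$. Nmatrices: an Nmatrix is a pair $\mathcal M=\langle\mathsf A,D\rangle$ with $\mathsf A$ a hyperalgebra over $\Sigma_\omega$ and $D\subseteq A$ the designated values. A valuation over $\mathcal M$ is a map $v:For(\Sigma_\omega)\to A$ with $v(\alpha\,\#\,\beta)\in v(\alpha)\,\tilde\#\,v(\beta)$ for each binary $\#$, and $v(\neg\alpha)\in\tilde\neg v(\alpha)$, where $\tilde\#,\tilde\neg$ are the interpretations in $\mathsf A$. $\Gamma\models_{\mathcal M}\varphi$ means: for every valuation $v$, if $v(\gamma)\in D$ for all $\gamma\in\Gamma$ then $v(\varphi)\in D$. $\Gamma\models_{\mathbb{HC}_\omega}\varphi$ means $\Gamma\models_{\langle\mathsf H,\top\rangle}\varphi$ for every HC$_\omega$A $\mathsf H$, where $\top=\mathsf{Max}(H)$. Hyper swap structures: for an IHL $\mathsf L$, let $S^{C_\omega}_{\mathsf L}=\{z=(z_1,z_2)\in L\times L: z_1\curlyvee z_2\equiv\top\}$, and let $\mathsf S(\mathsf L)$ be the hyperalgebra with domain $S^{C_\omega}_{\mathsf L}$ and $z\curlywedge w=\{u: u_1\in z_1\curlywedge w_1\}$, $z\curlyvee w=\{u: u_1\in z_1\curlyvee w_1\}$, $z\multimap w=\{u: u_1\in z_1\multimap w_1\}$, $\div z=\{u: u_1=z_2\text{ and }u_2\preceq z_1\}$ ($u$ ranging over $S^{C_\omega}_{\mathsf L}$). Let $\mathcal M(\mathsf L)=\langle\mathsf S(\mathsf L),D^{C_\omega}_{\mathsf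 L}\rangle$ with $D^{C_\omega}_{\mathsf L}=\{z\in S^{C_\omega}_{\mathsf L}: z_1\in\top\}$. $\Gamma\models_{C_\omega}^{HSW}\varphi$ means $\Gamma\models_{\mathcal M(\mathsf L)}\varphi$ for every IHL $\mathsf L$. *)

theory Defs
  imports Main
begin

section \<open>Formulas and the Hilbert calculus\<close>

text \<open>The free algebra over the signature with denumerably many generators.\<close>

datatype fm =
    Var nat
  | And fm fm (infixr "\<^bold>\<and>" 65)
  | Or fm fm (infixr "\<^bold>\<or>" 60)
  | Imp fm fm (infixr "\<^bold>\<rightarrow>" 55)
  | Neg fm ("\<^bold>\<not> _" [70] 70)

inductive axiom_Comega :: "fm \<Rightarrow> bool" where
  "axiom_Comega (\<alpha> \<^bold>\<rightarrow> (\<beta> \<^bold>\<rightarrow> \<alpha>))"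
| "axiom_Comega ((\<alpha> \<^bold>\<rightarrow> (\<beta> \<^bold>\<rightarrow> \<gamma>)) \<^bold>\<rightarrow> ((\<alpha> \<^bold>\<rightarrow> \<beta>) \<^bold>\<rightarrow> (\<alpha> \<^bold>\<rightarrow> \<gamma>)))"
| "axiom_Comega (\<alpha> \<^bold>\<rightarrow> (\<beta> \<^bold>\<rightarrow> (\<alpha> \<^bold>\<and> \<beta>)))"
| "axiom_Comega ((\<alpha> \<^bold>\<and> \<beta>) \<^bold>\<rightarrow> \<alpha>)"
| "axiom_Comega ((\<alpha> \<^bold>\<and> \<beta>) \<^bold>\<rightarrow> \<beta>)"
| "axiom_Comega (\<alpha> \<^bold>\<rightarrow> (\<alpha> \<^bold>\<or> \<beta>))"
| "axiom_Comega (\<beta> \<^bold>\<rightarrow> (\<alpha> \<^bold>\<or> \<beta>))"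
| "axiom_Comega ((\<alpha> \<^bold>\<rightarrow> \<gamma>) \<^bold>\<rightarrow> ((\<beta> \<^bold>\<rightarrow> \<gamma>) \<^bold>\<rightarrow> ((\<alpha> \<^bold>\<or> \<beta>) \<^bold>\<rightarrow> \<gamma>)))"
| "axiom_Comega (\<alpha> \<^bold>\<or> \<^bold>\<not> \<alpha>)"
| "axiom_Comega (\<^bold>\<not> (\<^bold>\<not> \<alpha>) \<^bold>\<rightarrow> \<alpha>)"

inductive deriv_Comega :: "fm set \<Rightarrow> fm \<Rightarrow> bool" (infix "\<turnstile>\<^sub>C\<^sub>\<omega>" 50)
  for \<Gamma> :: "fm set"
where
  hyp: "\<phi> \<in> \<Gamma> \<Longrightarrow> \<Gamma> \<turnstile>\<^sub>C\<^sub>\<omega> \<phi>"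
| ax: "axiom_Comega \<phi> \<Longrightarrow> \<Gamma> \<turnstile>\<^sub>C\<^sub>\<omega> \<phi>"
| mp: "\<Gamma> \<turnstile>\<^sub>C\<^sub>\<omega> \<alpha> \<Longrightarrow> \<Gamma> \<turnstile>\<^sub>C\<^sub>\<omega> \<alpha> \<^bold>\<rightarrow> \<beta> \<Longrightarrow> \<Gamma> \<turnstile>\<^sub>C\<^sub>\<omega> \<beta>"

section \<open>Prosets\<close>

locale proset =
  fixes P :: "'a set" and le :: "'a \<Rightarrow> 'a \<Rightarrow> bool" (infix "\<preceq>" 50)
  assumes nonempty: "P \<noteq> {}"
    and refl: "reflp_on P (\<preceq>)"
    and trans: "transp_on P (\<preceq>)"
begin

definition equi :: "'a \<Rightarrow> 'a \<Rightarrow> bool" (infix "\<approx>" 50)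
  where "x \<approx> y \<longleftrightarrow> x \<preceq> y \<and> y \<preceq> x"

definition set_le :: "'a set \<Rightarrow> 'a set \<Rightarrow> bool" (infix "\<lesssim>" 50)
  where "A \<lesssim> B \<longleftrightarrow> (\<forall>a\<in>A. \<forall>b\<in>B. a \<preceq> b)"

definition set_equi :: "'a set \<Rightarrow> 'a set \<Rightarrow> bool" (infix "\<cong>" 50)
  where "A \<cong> B \<longleftrightarrow> (\<forall>a\<in>A. \<forall>b\<in>B. a \<approx> b)"

definition minima :: "'a set \<Rightarrow> 'a set"
  where "minima B = {x \<in> B. {x} \<lesssim> B}"

definition maxima :: "'a set \<Rightarrow> 'a set"
  where "maxima B = {x \<in> B. B \<lesssim> {x}}"

definition upper_bounds :: "'a set \<Rightarrow> 'a set"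
  where "upper_bounds B = {x \<in> P. B \<lesssim> {x}}"

definition lower_bounds :: "'a set \<Rightarrow> 'a set"
  where "lower_bounds B = {x \<in> P. {x} \<lesssim> B}"

definition tops :: "'a set"
  where "tops = maxima P"

end

section \<open>Hyperalgebras\<close>

definition hyperop1 :: "'a set \<Rightarrow> ('a \<Rightarrow> 'a set) \<Rightarrow> bool"
  where "hyperop1 A f \<longleftrightarrow> (\<forall>x\<in>A. f x \<noteq> {} \<and> f x \<subseteq> A)"

definition hyperop2 :: "'a set \<Rightarrow> ('a \<Rightarrow> 'a \<Rightarrow> 'a set) \<Rightarrow> bool"
  where "hyperop2 A f \<longleftrightarrow> (\<forall>x\<in>A. \<forall>y\<in>A. f x y \<noteq> {} \<and> f x y \<subseteq> A)"

record 'a pos_hyperalgebra =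
  carrier :: "'a set"
  hmeet :: "'a \<Rightarrow> 'a \<Rightarrow> 'a set"
  hjoin :: "'a \<Rightarrow> 'a \<Rightarrow> 'a set"
  himp :: "'a \<Rightarrow> 'a \<Rightarrow> 'a set"

text \<open>The record extension makes the negation-free reduct implicit: a predicate on the
  scheme of \<open>pos_hyperalgebra\<close>, such as \<open>IHL\<close> below, only looks at that reduct.\<close>

record 'a hyperalgebra = "'a pos_hyperalgebra" +
  hneg :: "'a \<Rightarrow> 'a set"

locale hyperlattice = proset "carrier L" le
  for L :: "('a, 'm) pos_hyperalgebra_scheme" and le :: "'a \<Rightarrow> 'a \<Rightarrow> bool" (infix "\<preceq>" 50) +
  assumes join_eq: "\<lbrakk>x \<in> carrier L; y \<in> carrier L\<rbrakk> \<Longrightarrow> hjoin L x y = minima (upper_bounds {x, y})"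
    and meet_eq: "\<lbrakk>x \<in> carrier L; y \<in> carrier L\<rbrakk> \<Longrightarrow> hmeet L x y = maxima (lower_bounds {x, y})"
    and hyperop_join: "hyperop2 (carrier L) (hjoin L)"
    and hyperop_meet: "hyperop2 (carrier L) (hmeet L)"

locale IHL = hyperlattice L le
  for L :: "('a, 'm) pos_hyperalgebra_scheme" and le :: "'a \<Rightarrow> 'a \<Rightarrow> bool" (infix "\<preceq>" 50) +
  assumes hyperop_imp: "hyperop2 (carrier L) (himp L)"
    and imp_elim: "\<lbrakk>x \<in> carrier L; y \<in> carrier L; z \<in> carrier L; z \<in> himp L x y\<rbrakk>
        \<Longrightarrow> hmeet L x z \<lesssim> {y}"
    and imp_intro: "\<lbrakk>x \<in> carrier L; y \<in> carrier L; z \<in> carrier L; hmeet L x z \<lesssim> {y}\<rbrakk>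
        \<Longrightarrow> {z} \<lesssim> himp L x y"
    and imp_closed: "\<lbrakk>x \<in> carrier L; y \<in> carrier L; z \<in> carrier L; z' \<in> carrier L;
        z \<approx> z'; z \<in> himp L x y\<rbrakk> \<Longrightarrow> z' \<in> himp L x y"

locale HComegaA = IHL H le
  for H :: "'a hyperalgebra" and le :: "'a \<Rightarrow> 'a \<Rightarrow> bool" (infix "\<preceq>" 50) +
  assumes hyperop_neg: "hyperop1 (carrier H) (hneg H)"
    and excluded_middle: "\<lbrakk>x \<in> carrier H; y \<in> carrier H; w \<in> carrier H;
        y \<in> hneg H x; w \<in> hjoin H x y\<rbrakk> \<Longrightarrow> w \<in> tops"
    and double_neg: "\<lbrakk>x \<in> carrier H; y \<in> carrier H; w \<in> carrier H;
        y \<in> hneg H x; w \<in> hneg H y\<rbrakk> \<Longrightarrow> w \<preceq> x"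

section \<open>Nmatrices\<close>

definition valuation :: "'a hyperalgebra \<Rightarrow> (fm \<Rightarrow> 'a) \<Rightarrow> bool" where
  "valuation A v \<longleftrightarrow>
     (\<forall>\<alpha>. v \<alpha> \<in> carrier A) \<and>
     (\<forall>\<alpha> \<beta>. v (\<alpha> \<^bold>\<and> \<beta>) \<in> hmeet A (v \<alpha>) (v \<beta>)) \<and>
     (\<forall>\<alpha> \<beta>. v (\<alpha> \<^bold>\<or> \<beta>) \<in> hjoin A (v \<alpha>) (v \<beta>)) \<and>
     (\<forall>\<alpha> \<beta>. v (\<alpha> \<^bold>\<rightarrow> \<beta>) \<in> himp A (v \<alpha>) (v \<beta>)) \<and>
     (\<forall>\<alpha>. v (\<^bold>\<not> \<alpha>) \<in> hneg A (v \<alpha>))"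

definition nmatrix_conseq :: "'a hyperalgebra \<times> 'a set \<Rightarrow> fm set \<Rightarrow> fm \<Rightarrow> bool" where
  "nmatrix_conseq M \<Gamma> \<phi> \<longleftrightarrow>
     (\<forall>v. valuation (fst M) v \<longrightarrow> (\<forall>\<gamma>\<in>\<Gamma>. v \<gamma> \<in> snd M) \<longrightarrow> v \<phi> \<in> snd M)"

section \<open>Hyper swap structures\<close>

context proset
begin

definition swap_dom :: "('a \<Rightarrow> 'a \<Rightarrow> 'a set) \<Rightarrow> ('a \<times> 'a) set"
  where "swap_dom join = {z \<in> P \<times> P. join (fst z) (snd z) \<cong> tops}"

end

context IHL
begin

definition swap_structure :: "('a \<times> 'a) hyperalgebra" where
  "swap_structure =
    \<lparr> carrier = swap_dom (hjoin L),
      hmeet = (\<lambda>z w. {u \<in> swap_dom (hjoin L). fst u \<in> hmeet L (fst z) (fst w)}),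
      hjoin = (\<lambda>z w. {u \<in> swap_dom (hjoin L). fst u \<in> hjoin L (fst z) (fst w)}),
      himp = (\<lambda>z w. {u \<in> swap_dom (hjoin L). fst u \<in> himp L (fst z) (fst w)}),
      hneg = (\<lambda>z. {u \<in> swap_dom (hjoin L). fst u = snd z \<and> snd u \<preceq> fst z}) \<rparr>"

definition swap_designated :: "('a \<times> 'a) set"
  where "swap_designated = {z \<in> swap_dom (hjoin L). fst z \<in> tops}"

definition swap_nmatrix :: "('a \<times> 'a) hyperalgebra \<times> ('a \<times> 'a) set"
  where "swap_nmatrix = (swap_structure, swap_designated)"

end

section \<open>Semantic consequence\<close>

text \<open>HOL cannot quantify over types inside a formula, so the class of algebras ranged over is
  that of all algebras whose carrier is a subset of the type given as first argument. The
  carrier is not required to be the whole type, so every algebra whose carrier injects into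
  the type has an isomorphic copy in this class.\<close>

definition HComega_conseq :: "'a itself \<Rightarrow> fm set \<Rightarrow> fm \<Rightarrow> bool" where
  "HComega_conseq T \<Gamma> \<phi> \<longleftrightarrow>
     (\<forall>(H :: 'a hyperalgebra) le. HComegaA H le \<longrightarrow>
        nmatrix_conseq (H, proset.tops (carrier H) le) \<Gamma> \<phi>)"

definition HSW_conseq :: "'a itself \<Rightarrow> fm set \<Rightarrow> fm \<Rightarrow> bool" where
  "HSW_conseq T \<Gamma> \<phi> \<longleftrightarrow>
     (\<forall>(L :: 'a pos_hyperalgebra) le. IHL L le \<longrightarrow>
        nmatrix_conseq (IHL.swap_nmatrix L le) \<Gamma> \<phi>)"

end

theory Submission
  imports Defs "HOL-Library.Countable"
begin

text \<open>
  In an IHL the elements of the hyperoperations are determined by universal properties, e.g. the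
  elements below \<open>x \<multimap> y\<close> are those \<open>c\<close> such that everything below \<open>x\<close> and \<open>c\<close> is below \<open>y\<close>. Since
  \<open>v (\<alpha> \<rightarrow> \<beta>)\<close> is a top element iff \<open>v \<alpha> \<preceq> v \<beta>\<close>, these properties give soundness for \<open>HC\<^sub>\<omega>\<close> algebras.
  A swap structure, preordered by first components, is itself an \<open>HC\<^sub>\<omega>\<close> algebra whose top elements
  are the designated values, so it inherits soundness. For completeness, the formulas preordered by
  \<open>\<Gamma> \<turnstile> \<alpha> \<rightarrow> \<beta>\<close> form an \<open>HC\<^sub>\<omega>\<close> algebra; no quotient is needed because the operations are multivalued.
  The identity refutes underivable formulas there, and \<open>\<alpha> \<mapsto> (\<alpha>, \<not>\<alpha>)\<close> does so in its swap
  structure.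
\<close>

section \<open>Universal properties of the hyperoperations\<close>

context proset
begin

lemma order_refl: "x \<in> P \<Longrightarrow> x \<preceq> x"
  using refl by (auto dest: reflp_onD)

lemma order_trans: "x \<preceq> y \<Longrightarrow> y \<preceq> z \<Longrightarrow> x \<in> P \<Longrightarrow> y \<in> P \<Longrightarrow> z \<in> P \<Longrightarrow> x \<preceq> z"
  using trans by (blast dest: transp_onD)

lemma mem_tops: "t \<in> tops \<longleftrightarrow> t \<in> P \<and> (\<forall>c\<in>P. c \<preceq> t)"
  by (auto simp: tops_def maxima_def set_le_def)

text \<open>Transitivity gives one direction; conversely, the instance \<open>c = m\<close> makes
  \<open>m\<close> a lower bound and the remaining instances make it greatest. Since
  \<open>m\<close> enters only through the order, this form transports easily to pairs and
  formulas.\<close>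

lemma mem_maxima_lower_bounds:
  assumes "x \<in> P" "y \<in> P"
  shows "m \<in> maxima (lower_bounds {x, y}) \<longleftrightarrow>
    m \<in> P \<and> (\<forall>c\<in>P. c \<preceq> m \<longleftrightarrow> c \<preceq> x \<and> c \<preceq> y)"
  unfolding maxima_def lower_bounds_def set_le_def
  using assms by (auto intro: order_refl order_trans[rotated])

lemma mem_minima_upper_bounds:
  assumes "x \<in> P" "y \<in> P"
  shows "j \<in> minima (upper_bounds {x, y}) \<longleftrightarrow>
    j \<in> P \<and> (\<forall>c\<in>P. j \<preceq> c \<longleftrightarrow> x \<preceq> c \<and> y \<preceq> c)"
  unfolding minima_def upper_bounds_def set_le_def
  using assms by (auto intro: order_refl order_trans[rotated])

text \<open>Anything above a top element is itself top, so equivalence with \<open>tops\<close>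
  collapses to inclusion. If there were no top element, the equivalence would hold vacuously for
  every set, hence the second assumption.\<close>

lemma mem_swap_dom:
  assumes "\<And>x y. x \<in> P \<Longrightarrow> y \<in> P \<Longrightarrow> join x y \<subseteq> P" and "tops \<noteq> {}"
  shows "z \<in> swap_dom join \<longleftrightarrow> fst z \<in> P \<and> snd z \<in> P \<and> join (fst z) (snd z) \<subseteq> tops"
proof -
  have "A \<cong> tops \<longleftrightarrow> A \<subseteq> tops" if "A \<subseteq> P" for A
  proof -
    obtain t where t: "t \<in> tops"
      using assms(2) by blast
    have "a \<in> tops" if "a \<in> P" "t \<preceq> a" for a
      using that t order_trans[of _ t a] by (auto simp: mem_tops)
    then show ?thesis
      using that t by (auto simp: set_equi_def equi_def mem_tops)
  qed
  then show ?thesis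
    using assms(1) by (auto simp: swap_dom_def mem_Times_iff)
qed

end

context hyperlattice
begin

lemma mem_hmeet:
  assumes "x \<in> carrier L" "y \<in> carrier L"
  shows "m \<in> hmeet L x y \<longleftrightarrow>
    m \<in> carrier L \<and> (\<forall>c\<in>carrier L. c \<preceq> m \<longleftrightarrow> c \<preceq> x \<and> c \<preceq> y)"
  using assms by (simp add: meet_eq mem_maxima_lower_bounds)

lemma mem_hjoin:
  assumes "x \<in> carrier L" "y \<in> carrier L"
  shows "j \<in> hjoin L x y \<longleftrightarrow>
    j \<in> carrier L \<and> (\<forall>c\<in>carrier L. j \<preceq> c \<longleftrightarrow> x \<preceq> c \<and> y \<preceq> c)"
  using assms by (simp add: join_eq mem_minima_upper_bounds)

lemma hmeet_le:
  assumes "x \<in> carrier L" "y \<in> carrier L" "m \<in> hmeet L x y"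
  shows "m \<in> carrier L \<and> m \<preceq> x \<and> m \<preceq> y"
  using assms order_refl mem_hmeet by blast

lemma ex_hmeet: "x \<in> carrier L \<Longrightarrow> y \<in> carrier L \<Longrightarrow> \<exists>m. m \<in> hmeet L x y"
  using hyperop_meet unfolding hyperop2_def by blast

lemma ex_hjoin: "x \<in> carrier L \<Longrightarrow> y \<in> carrier L \<Longrightarrow> \<exists>j. j \<in> hjoin L x y"
  using hyperop_join unfolding hyperop2_def by blast

end

context IHL
begin

lemma ex_himp: "x \<in> carrier L \<Longrightarrow> y \<in> carrier L \<Longrightarrow> \<exists>z. z \<in> himp L x y"
  using hyperop_imp unfolding hyperop2_def by blast

text \<open>All members of \<open>hmeet L x c\<close> have the same elements below them, so a single
  member decides the inequality for the whole set.\<close>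

lemma hmeet_set_le_iff:
  assumes "x \<in> carrier L" "y \<in> carrier L" "c \<in> carrier L"
  shows "hmeet L x c \<lesssim> {y} \<longleftrightarrow> (\<forall>d\<in>carrier L. d \<preceq> x \<longrightarrow> d \<preceq> c \<longrightarrow> d \<preceq> y)"
proof
  assume le: "hmeet L x c \<lesssim> {y}"
  obtain m where m: "m \<in> hmeet L x c"
    using ex_hmeet assms by blast
  then have "m \<preceq> y"
    using le by (auto simp: set_le_def)
  then show "\<forall>d\<in>carrier L. d \<preceq> x \<longrightarrow> d \<preceq> c \<longrightarrow> d \<preceq> y"
    using m assms order_trans[of _ m y] by (simp add: mem_hmeet)
next
  assume "\<forall>d\<in>carrier L. d \<preceq> x \<longrightarrow> d \<preceq> c \<longrightarrow> d \<preceq> y"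
  then show "hmeet L x c \<lesssim> {y}"
    unfolding set_le_def using assms hmeet_le by (metis singletonD)
qed

text \<open>\<open>imp_elim\<close> makes \<open>z\<close> one of the admissible elements
  \<open>c\<close>, and \<open>imp_intro\<close> puts every admissible \<open>c\<close> below
  \<open>z\<close>.\<close>

lemma himpD:
  assumes "x \<in> carrier L" "y \<in> carrier L" "z \<in> himp L x y"
  shows "z \<in> carrier L \<and>
    (\<forall>c\<in>carrier L. c \<preceq> z \<longleftrightarrow> (\<forall>d\<in>carrier L. d \<preceq> x \<longrightarrow> d \<preceq> c \<longrightarrow> d \<preceq> y))"
proof -
  have z: "z \<in> carrier L"
    using assms hyperop_imp unfolding hyperop2_def by blast
  then have "\<forall>d\<in>carrier L. d \<preceq> x \<longrightarrow> d \<preceq> z \<longrightarrow> d \<preceq> y"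
    using imp_elim assms hmeet_set_le_iff by blast
  moreover have "c \<preceq> z" if "c \<in> carrier L" "\<forall>d\<in>carrier L. d \<preceq> x \<longrightarrow> d \<preceq> c \<longrightarrow> d \<preceq> y" for c
    using imp_intro[of x y c] that assms hmeet_set_le_iff by (auto simp: set_le_def)
  ultimately show ?thesis
    using z order_trans by blast
qed

text \<open>Two elements with this property lie below each other. As \<open>himp L x y\<close> has a
  member, which has the property by \<open>himpD\<close>, and is closed under equivalence, it
  contains all the others.\<close>

lemma mem_himp:
  assumes "x \<in> carrier L" "y \<in> carrier L"
  shows "z \<in> himp L x y \<longleftrightarrow> z \<in> carrier L \<and>
    (\<forall>c\<in>carrier L. c \<preceq> z \<longleftrightarrow> (\<forall>d\<in>carrier L. d \<preceq> x \<longrightarrow> d \<preceq> c \<longrightarrow> d \<preceq> y))"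
    (is "_ \<longleftrightarrow> ?R z")
proof
  assume z: "?R z"
  obtain z' where z': "z' \<in> himp L x y"
    using ex_himp assms by blast
  then have "?R z'"
    using himpD assms by blast
  then have "z' \<in> carrier L" "z' \<approx> z"
    using z order_refl by (auto simp: equi_def)
  then show "z \<in> himp L x y"
    using imp_closed z z' assms by blast
qed (use assms himpD in blast)

text \<open>The instance \<open>c = d = x\<close> gives the forward direction and transitivity the
  other. This turns designated implications into inequalities.\<close>

lemma himp_top_iff:
  assumes "x \<in> carrier L" "y \<in> carrier L" "z \<in> himp L x y"
  shows "z \<in> tops \<longleftrightarrow> x \<preceq> y"
  using assms order_refl order_trans unfolding mem_tops mem_himp[OF assms(1,2)] by blast

lemma tops_nonempty: "tops \<noteq> {}"
proof -
  obtain x where "x \<in> carrier L"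
    using nonempty by blast
  moreover from this obtain z where "z \<in> himp L x x"
    using ex_himp by blast
  ultimately show ?thesis
    using himp_top_iff order_refl by blast
qed

end

text \<open>Converse to the membership lemmas above: constructing an IHL reduces to the universal
  properties and non-emptiness. Both the swap structure and the Lindenbaum algebra are obtained this
  way.\<close>

lemma IHLI:
  assumes "proset (carrier L) le"
    and meet: "\<And>x y m. x \<in> carrier L \<Longrightarrow> y \<in> carrier L \<Longrightarrow> m \<in> hmeet L x y \<longleftrightarrow>
      m \<in> carrier L \<and> (\<forall>c\<in>carrier L. le c m \<longleftrightarrow> le c x \<and> le c y)"
    and join: "\<And>x y j. x \<in> carrier L \<Longrightarrow> y \<in> carrier L \<Longrightarrow> j \<in> hjoin L x y \<longleftrightarrow>
      j \<in> carrier L \<and> (\<forall>c\<in>carrier L. le j c \<longleftrightarrow> le x c \<and> le y c)"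
    and imp: "\<And>x y z. x \<in> carrier L \<Longrightarrow> y \<in> carrier L \<Longrightarrow> z \<in> himp L x y \<longleftrightarrow> z \<in> carrier L \<and>
      (\<forall>c\<in>carrier L. le c z \<longleftrightarrow> (\<forall>d\<in>carrier L. le d x \<longrightarrow> le d c \<longrightarrow> le d y))"
    and ex_meet: "\<And>x y. x \<in> carrier L \<Longrightarrow> y \<in> carrier L \<Longrightarrow> \<exists>m. m \<in> hmeet L x y"
    and ex_join: "\<And>x y. x \<in> carrier L \<Longrightarrow> y \<in> carrier L \<Longrightarrow> \<exists>j. j \<in> hjoin L x y"
    and ex_imp: "\<And>x y. x \<in> carrier L \<Longrightarrow> y \<in> carrier L \<Longrightarrow> \<exists>z. z \<in> himp L x y"
  shows "IHL L le"
proof -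
  interpret proset "carrier L" le by fact
  interpret hyperlattice L le
  proof
    fix x y
    assume xy: "x \<in> carrier L" "y \<in> carrier L"
    show "hjoin L x y = minima (upper_bounds {x, y})"
      unfolding set_eq_iff join[OF xy] mem_minima_upper_bounds[OF xy] by simp
    show "hmeet L x y = maxima (lower_bounds {x, y})"
      unfolding set_eq_iff meet[OF xy] mem_maxima_lower_bounds[OF xy] by simp
  next
    show "hyperop2 (carrier L) (hjoin L)"
      unfolding hyperop2_def using ex_join by (fastforce simp: join)
    show "hyperop2 (carrier L) (hmeet L)"
      unfolding hyperop2_def using ex_meet by (fastforce simp: meet)
  qed
  show ?thesis
  proof
    show "hyperop2 (carrier L) (himp L)"
      unfolding hyperop2_def using ex_imp by (fastforce simp: imp)
  next
    fix x y z
    assume xyz: "x \<in> carrier L" "y \<in> carrier L" "z \<in> carrier L"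
    show "set_le (hmeet L x z) {y}" if "z \<in> himp L x y"
    proof -
      have "le m y" if m: "m \<in> hmeet L x z" for m
      proof -
        have "m \<in> carrier L" "le m x" "le m z"
          using m order_refl unfolding meet[OF xyz(1,3)] by blast+
        then show ?thesis
          using \<open>z \<in> himp L x y\<close> order_refl[of z] xyz(3) unfolding imp[OF xyz(1,2)] by blast
      qed
      then show ?thesis
        by (simp add: set_le_def)
    qed
    show "set_le {z} (himp L x y)" if le: "set_le (hmeet L x z) {y}"
    proof -
      obtain m where m: "m \<in> hmeet L x z"
        using ex_meet xyz by blast
      then have "le m y"
        using le by (auto simp: set_le_def)
      then have "le d y" if "d \<in> carrier L" "le d x" "le d z" for d
        using that m \<open>le m y\<close> order_trans[of d m y] xyz(2) unfolding meet[OF xyz(1,3)] by blast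
      then show ?thesis
        using imp[OF xyz(1,2)] xyz by (auto simp: set_le_def)
    qed
  next
    fix x y z z'
    assume *: "x \<in> carrier L" "y \<in> carrier L" "z \<in> carrier L" "z' \<in> carrier L"
      "equi z z'" "z \<in> himp L x y"
    then have "le c z' \<longleftrightarrow> le c z" if "c \<in> carrier L" for c
      using that order_trans[of c z z'] order_trans[of c z' z] by (auto simp: equi_def)
    then show "z' \<in> himp L x y"
      using * by (simp add: imp)
  qed
qed

section \<open>Soundness\<close>

context HComegaA
begin

text \<open>For the positive axioms, \<open>T\<close> reduces a designated implication to an
  inequality, and \<open>A\<close>, \<open>O\<close> and \<open>I\<close> replace connectives by
  universal properties, so that only order reasoning remains. The two negation axioms match the two
  negation laws of the algebra.\<close>

lemma axiom_Comega_sound: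
  assumes v: "valuation H v" and ax: "axiom_Comega \<phi>"
  shows "v \<phi> \<in> tops"
proof -
  have C [simp]: "v \<alpha> \<in> carrier H" for \<alpha>
    using v by (auto simp: valuation_def)
  have A: "c \<preceq> v (\<alpha> \<^bold>\<and> \<beta>) \<longleftrightarrow> c \<preceq> v \<alpha> \<and> c \<preceq> v \<beta>" if "c \<in> carrier H" for c \<alpha> \<beta>
    using v that by (auto simp: valuation_def mem_hmeet)
  have O: "v (\<alpha> \<^bold>\<or> \<beta>) \<preceq> c \<longleftrightarrow> v \<alpha> \<preceq> c \<and> v \<beta> \<preceq> c" if "c \<in> carrier H" for c \<alpha> \<beta>
    using v that by (auto simp: valuation_def mem_hjoin)
  have Imp: "v (\<alpha> \<^bold>\<rightarrow> \<beta>) \<in> himp H (v \<alpha>) (v \<beta>)" for \<alpha> \<beta>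
    using v by (auto simp: valuation_def)
  have I: "c \<preceq> v (\<alpha> \<^bold>\<rightarrow> \<beta>) \<longleftrightarrow> (\<forall>d\<in>carrier H. d \<preceq> v \<alpha> \<longrightarrow> d \<preceq> c \<longrightarrow> d \<preceq> v \<beta>)"
    if "c \<in> carrier H" for c \<alpha> \<beta>
    using Imp[of \<alpha> \<beta>] that by (simp add: mem_himp)
  have T: "v (\<alpha> \<^bold>\<rightarrow> \<beta>) \<in> tops \<longleftrightarrow> v \<alpha> \<preceq> v \<beta>" for \<alpha> \<beta>
    using himp_top_iff[OF C C Imp] .
  show ?thesis
    using ax
  proof cases
    case (1 \<alpha> \<beta>)
    show ?thesis unfolding 1 T I[OF C] using order_trans C by blast
  next
    case (2 \<alpha> \<beta> \<gamma>)
    \<comment> \<open>The quantified element in \<open>I\<close> is always \<open>c\<close> itself: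
      being below the value of \<alpha>, it is below those of \<beta> and \<beta> \<rightarrow>
      \<gamma>, hence below that of \<gamma>.\<close>
    have "c \<preceq> v \<gamma>" if c: "c \<in> carrier H" "c \<preceq> v (\<alpha> \<^bold>\<rightarrow> (\<beta> \<^bold>\<rightarrow> \<gamma>))" "c \<preceq> v (\<alpha> \<^bold>\<rightarrow> \<beta>)" "c \<preceq> v \<alpha>" for c
      using c I order_refl by blast
    then show ?thesis unfolding 2 T using I order_trans C by (smt (verit))
  next
    case (3 \<alpha> \<beta>)
    show ?thesis unfolding 3 T using I A order_trans C by (smt (verit))
  next
    case (4 \<alpha> \<beta>)
    show ?thesis unfolding 4 T using A C order_refl by blast
  next
    case (5 \<alpha> \<beta>)
    show ?thesis unfolding 5 T using A C order_refl by blast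
  next
    case (6 \<alpha> \<beta>)
    show ?thesis unfolding 6 T using O C order_refl by blast
  next
    case (7 \<alpha> \<beta>)
    show ?thesis unfolding 7 T using O C order_refl by blast
  next
    case (8 \<alpha> \<gamma> \<beta>)
    have "c \<preceq> v \<gamma>" if c: "c \<in> carrier H" "c \<preceq> v (\<alpha> \<^bold>\<rightarrow> \<gamma>)" "c \<preceq> v (\<beta> \<^bold>\<rightarrow> \<gamma>)" "c \<preceq> v (\<alpha> \<^bold>\<or> \<beta>)" for c
    proof -
      \<comment> \<open>Residuation moves \<open>c\<close> to the right, where the universal property of the join applies.\<close>
      obtain n where "n \<in> himp H c (v \<gamma>)"
        using ex_himp c(1) C by blast
      then have n: "n \<in> carrier H"
        "\<And>d. d \<in> carrier H \<Longrightarrow> d \<preceq> n \<longleftrightarrow> (\<forall>e\<in>carrier H. e \<preceq> c \<longrightarrow> e \<preceq> d \<longrightarrow> e \<preceq> v \<gamma>)"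
        using c(1) by (auto simp: mem_himp)
      have "v \<alpha> \<preceq> n" "v \<beta> \<preceq> n"
        using c I[OF c(1)] n(2) C by blast+
      then have "v (\<alpha> \<^bold>\<or> \<beta>) \<preceq> n"
        using O n(1) by blast
      then show ?thesis
        using n(2)[OF C] c order_refl by blast
    qed
    then show ?thesis unfolding 8 T using I order_trans C by (smt (verit))
  next
    case (9 \<alpha>)
    show ?thesis
      unfolding 9 using v by (intro excluded_middle[OF C C C]) (auto simp: valuation_def)
  next
    case (10 \<alpha>)
    show ?thesis
      unfolding 10 T using v by (intro double_neg[OF C C C]) (auto simp: valuation_def)
  qed
qed

text \<open>Modus ponens preserves designation: a designated implication is an inequality by
  \<open>himp_top_iff\<close>, and what lies above a top element is top.\<close>

lemma deriv_Comega_sound: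
  assumes "\<Gamma> \<turnstile>\<^sub>C\<^sub>\<omega> \<phi>"
  shows "nmatrix_conseq (H, tops) \<Gamma> \<phi>"
proof -
  have "v \<phi> \<in> tops" if v: "valuation H v" "\<forall>\<gamma>\<in>\<Gamma>. v \<gamma> \<in> tops" for v
    using assms
  proof induction
    case (mp \<alpha> \<beta>)
    have C: "v \<gamma> \<in> carrier H" for \<gamma>
      using v by (auto simp: valuation_def)
    have "v (\<alpha> \<^bold>\<rightarrow> \<beta>) \<in> himp H (v \<alpha>) (v \<beta>)"
      using v by (auto simp: valuation_def)
    then have "v \<alpha> \<preceq> v \<beta>"
      using mp himp_top_iff[OF C C] by blast
    then show ?case
      using mp.IH C order_trans[of _ "v \<alpha>" "v \<beta>"] by (auto simp: mem_tops)
  qed (use v axiom_Comega_sound in auto)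
  then show ?thesis
    by (simp add: nmatrix_conseq_def)
qed

end

section \<open>Swap structures as algebras\<close>

context IHL
begin

lemma mem_swap_dom_hjoin:
  "z \<in> swap_dom (hjoin L) \<longleftrightarrow>
    fst z \<in> carrier L \<and> snd z \<in> carrier L \<and> hjoin L (fst z) (snd z) \<subseteq> tops"
  by (rule mem_swap_dom) (use hyperop_join tops_nonempty in \<open>auto simp: hyperop2_def\<close>)

text \<open>The order and the positive hyperoperations see only first components, and every element
  of \<open>L\<close> occurs as one, so the universal properties and the top elements carry over
  from \<open>L\<close>.\<close>

lemma swap_structure_HComegaA: "HComegaA swap_structure (\<lambda>z w. fst z \<preceq> fst w)"
  and swap_designated_eq_tops:
    "swap_designated = proset.tops (carrier swap_structure) (\<lambda>z w. fst z \<preceq> fst w)"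
proof -
  let ?S = "swap_dom (hjoin L)" and ?le = "\<lambda>z w. fst z \<preceq> fst w"
  obtain t where t: "t \<in> tops"
    using tops_nonempty by blast
  note S = mem_swap_dom_hjoin
  have t_carrier: "t \<in> carrier L"
    using t by (simp add: mem_tops)
  \<comment> \<open>A join with a top element is top, so pairing with \<open>t\<close> shows that
    the first projection is onto \<open>carrier L\<close>.\<close>
  have lift: "(x, t) \<in> ?S" if x: "x \<in> carrier L" for x
  proof -
    have "j \<in> tops" if "j \<in> hjoin L x t" for j
    proof -
      have "j \<in> carrier L" "t \<preceq> j"
        using that x t_carrier order_refl[of j] by (auto simp: mem_hjoin)
      then have "c \<preceq> j" if "c \<in> carrier L" for c
        using that t order_trans[of c t j] by (auto simp: mem_tops)
      then show ?thesis
        using \<open>j \<in> carrier L\<close> by (simp add: mem_tops)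
    qed
    then show ?thesis
      using x t_carrier by (auto simp: S)
  qed
  have ball: "(\<forall>z\<in>?S. Q (fst z)) \<longleftrightarrow> (\<forall>x\<in>carrier L. Q x)" for Q
    using lift S by force
  have ex: "\<exists>u. u \<in> ?S \<and> fst u \<in> B" if "\<exists>x. x \<in> B" "B \<subseteq> carrier L" for B
    using that lift by force
  have car: "carrier swap_structure = ?S"
    by (simp add: swap_structure_def)
  have pro: "proset ?S ?le"
  proof
    show "?S \<noteq> {}"
      using nonempty lift by auto
    show "reflp_on ?S ?le"
      using order_refl S by (auto intro: reflp_onI)
    show "transp_on ?S ?le"
      using order_trans S by (intro transp_onI) blast
  qed
  have "IHL swap_structure ?le"
  proof (rule IHLI, unfold car)
    fix x y u
    assume "x \<in> ?S" "y \<in> ?S"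
    then have xy: "fst x \<in> carrier L" "fst y \<in> carrier L"
      by (auto simp: S)
    show "u \<in> hmeet swap_structure x y \<longleftrightarrow> u \<in> ?S \<and>
        (\<forall>c\<in>?S. fst c \<preceq> fst u \<longleftrightarrow> fst c \<preceq> fst x \<and> fst c \<preceq> fst y)"
      using xy ball[of "\<lambda>c. c \<preceq> fst u \<longleftrightarrow> c \<preceq> fst x \<and> c \<preceq> fst y"]
      by (auto simp: swap_structure_def mem_hmeet S)
    show "u \<in> hjoin swap_structure x y \<longleftrightarrow> u \<in> ?S \<and>
        (\<forall>c\<in>?S. fst u \<preceq> fst c \<longleftrightarrow> fst x \<preceq> fst c \<and> fst y \<preceq> fst c)"
      using xy ball[of "\<lambda>c. fst u \<preceq> c \<longleftrightarrow> fst x \<preceq> c \<and> fst y \<preceq> c"]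
      by (auto simp: swap_structure_def mem_hjoin S)
    show "u \<in> himp swap_structure x y \<longleftrightarrow> u \<in> ?S \<and>
        (\<forall>c\<in>?S. fst c \<preceq> fst u \<longleftrightarrow>
          (\<forall>d\<in>?S. fst d \<preceq> fst x \<longrightarrow> fst d \<preceq> fst c \<longrightarrow> fst d \<preceq> fst y))"
      \<comment> \<open>Both quantifiers range over pairs: the first instance is for the inner one,
        the second for the outer one.\<close>
      using xy ball[of "\<lambda>d. d \<preceq> fst x \<longrightarrow> d \<preceq> _ \<longrightarrow> d \<preceq> fst y"]
        ball[of "\<lambda>c. c \<preceq> fst u \<longleftrightarrow>
          (\<forall>d\<in>carrier L. d \<preceq> fst x \<longrightarrow> d \<preceq> c \<longrightarrow> d \<preceq> fst y)"]
      by (auto simp: swap_structure_def mem_himp S)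
    show "\<exists>u. u \<in> hmeet swap_structure x y"
      using ex[OF ex_hmeet[OF xy]] xy hyperop_meet by (auto simp: swap_structure_def hyperop2_def)
    show "\<exists>u. u \<in> hjoin swap_structure x y"
      using ex[OF ex_hjoin[OF xy]] xy hyperop_join by (auto simp: swap_structure_def hyperop2_def)
    show "\<exists>u. u \<in> himp swap_structure x y"
      using ex[OF ex_himp[OF xy]] xy hyperop_imp by (auto simp: swap_structure_def hyperop2_def)
  qed (rule pro)
  then interpret S: IHL swap_structure ?le .
  have tops: "u \<in> S.tops \<longleftrightarrow> u \<in> ?S \<and> fst u \<in> tops" for u
    using ball[of "\<lambda>c. c \<preceq> fst u"] S.mem_tops[of u, unfolded car] S by (auto simp: mem_tops car)
  then show "swap_designated = S.tops"
    by (auto simp: swap_designated_def)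
  show "HComegaA swap_structure ?le"
  proof
    \<comment> \<open>The swapped pair witnesses that negation is non-empty; it stays in the domain
      because the join is commutative.\<close>
    have swap: "prod.swap z \<in> ?S" if "z \<in> ?S" for z
    proof -
      have "hjoin L (snd z) (fst z) = hjoin L (fst z) (snd z)"
        using that by (auto simp: S mem_hjoin)
      then show ?thesis
        using that by (simp add: S)
    qed
    have "prod.swap z \<in> hneg swap_structure z" if "z \<in> ?S" for z
      using swap[OF that] that order_refl by (auto simp: swap_structure_def S)
    then show "hyperop1 (carrier swap_structure) (hneg swap_structure)"
      unfolding hyperop1_def car by (fastforce simp: swap_structure_def)
  next
    fix x y w
    assume "x \<in> carrier swap_structure" "y \<in> hneg swap_structure x"
      and "w \<in> hjoin swap_structure x y"
    \<comment> \<open>Since \<open>fst y = snd x\<close>, the first component of \<open>w\<close> is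
      a join of the two components of \<open>x\<close>, which is top by the definition of the
      domain.\<close>
    then show "w \<in> S.tops"
      unfolding tops by (auto simp: swap_structure_def S)
  next
    fix x y w
    assume "y \<in> hneg swap_structure x" "w \<in> hneg swap_structure y"
    \<comment> \<open>Here \<open>fst w = snd y\<close>, and the second clause of negation puts
      \<open>snd y\<close> below \<open>fst x\<close>.\<close>
    then show "fst w \<preceq> fst x"
      by (auto simp: swap_structure_def)
  qed
qed

end

section \<open>The Lindenbaum algebra\<close>

lemma deriv_mono: "\<Gamma> \<turnstile>\<^sub>C\<^sub>\<omega> \<phi> \<Longrightarrow> \<Gamma> \<subseteq> \<Delta> \<Longrightarrow> \<Delta> \<turnstile>\<^sub>C\<^sub>\<omega> \<phi>"
  by (induction rule: deriv_Comega.induct) (auto intro: deriv_Comega.intros)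

lemma deriv_self_imp: "\<Gamma> \<turnstile>\<^sub>C\<^sub>\<omega> \<alpha> \<^bold>\<rightarrow> \<alpha>"
  by (meson axiom_Comega.intros(1,2) ax mp)

lemma deriv_weaken: "\<Gamma> \<turnstile>\<^sub>C\<^sub>\<omega> \<beta> \<Longrightarrow> \<Gamma> \<turnstile>\<^sub>C\<^sub>\<omega> \<alpha> \<^bold>\<rightarrow> \<beta>"
  by (erule mp) (intro ax axiom_Comega.intros)

lemma deriv_imp_mp:
  assumes "\<Gamma> \<turnstile>\<^sub>C\<^sub>\<omega> \<gamma> \<^bold>\<rightarrow> \<alpha>" "\<Gamma> \<turnstile>\<^sub>C\<^sub>\<omega> \<gamma> \<^bold>\<rightarrow> (\<alpha> \<^bold>\<rightarrow> \<beta>)"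
  shows "\<Gamma> \<turnstile>\<^sub>C\<^sub>\<omega> \<gamma> \<^bold>\<rightarrow> \<beta>"
  by (rule mp[OF assms(1) mp[OF assms(2)]]) (intro ax axiom_Comega.intros)

lemma deduction: "insert \<alpha> \<Gamma> \<turnstile>\<^sub>C\<^sub>\<omega> \<beta> \<longleftrightarrow> \<Gamma> \<turnstile>\<^sub>C\<^sub>\<omega> \<alpha> \<^bold>\<rightarrow> \<beta>"
proof
  assume "insert \<alpha> \<Gamma> \<turnstile>\<^sub>C\<^sub>\<omega> \<beta>"
  then show "\<Gamma> \<turnstile>\<^sub>C\<^sub>\<omega> \<alpha> \<^bold>\<rightarrow> \<beta>"
  proof induction
    case (mp \<beta> \<gamma>)
    then show ?case
      using deriv_imp_mp by blast
  qed (auto intro: deriv_weaken deriv_self_imp deriv_Comega.intros)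
next
  assume "\<Gamma> \<turnstile>\<^sub>C\<^sub>\<omega> \<alpha> \<^bold>\<rightarrow> \<beta>"
  then have "insert \<alpha> \<Gamma> \<turnstile>\<^sub>C\<^sub>\<omega> \<alpha> \<^bold>\<rightarrow> \<beta>"
    using deriv_mono by blast
  then show "insert \<alpha> \<Gamma> \<turnstile>\<^sub>C\<^sub>\<omega> \<beta>"
    by (rule mp[OF hyp[OF insertI1]])
qed

definition entails :: "fm set \<Rightarrow> fm \<Rightarrow> fm \<Rightarrow> bool" where
  "entails \<Gamma> \<alpha> \<beta> \<longleftrightarrow> \<Gamma> \<turnstile>\<^sub>C\<^sub>\<omega> \<alpha> \<^bold>\<rightarrow> \<beta>"

lemma entails_refl: "entails \<Gamma> \<alpha> \<alpha>"
  by (simp add: entails_def deriv_self_imp)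

lemma entails_trans: "entails \<Gamma> \<alpha> \<beta> \<Longrightarrow> entails \<Gamma> \<beta> \<gamma> \<Longrightarrow> entails \<Gamma> \<alpha> \<gamma>"
  unfolding entails_def by (blast intro: deriv_imp_mp deriv_weaken)

lemma entails_axiom: "axiom_Comega (\<alpha> \<^bold>\<rightarrow> \<beta>) \<Longrightarrow> entails \<Gamma> \<alpha> \<beta>"
  unfolding entails_def by (rule ax)

lemma entails_And: "entails \<Gamma> \<gamma> (\<alpha> \<^bold>\<and> \<beta>) \<longleftrightarrow> entails \<Gamma> \<gamma> \<alpha> \<and> entails \<Gamma> \<gamma> \<beta>"
proof
  assume "entails \<Gamma> \<gamma> (\<alpha> \<^bold>\<and> \<beta>)"
  then show "entails \<Gamma> \<gamma> \<alpha> \<and> entails \<Gamma> \<gamma> \<beta>"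
    using entails_axiom[OF axiom_Comega.intros(4)] entails_axiom[OF axiom_Comega.intros(5)]
      entails_trans by blast
next
  assume "entails \<Gamma> \<gamma> \<alpha> \<and> entails \<Gamma> \<gamma> \<beta>"
  then show "entails \<Gamma> \<gamma> (\<alpha> \<^bold>\<and> \<beta>)"
    using entails_axiom[OF axiom_Comega.intros(3)] entails_trans deriv_imp_mp
    unfolding entails_def by blast
qed

lemma entails_Or: "entails \<Gamma> (\<alpha> \<^bold>\<or> \<beta>) \<gamma> \<longleftrightarrow> entails \<Gamma> \<alpha> \<gamma> \<and> entails \<Gamma> \<beta> \<gamma>"
proof
  assume "entails \<Gamma> (\<alpha> \<^bold>\<or> \<beta>) \<gamma>"
  moreover have "entails \<Gamma> \<alpha> (\<alpha> \<^bold>\<or> \<beta>)" "entails \<Gamma> \<beta> (\<alpha> \<^bold>\<or> \<beta>)"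
    by (intro entails_axiom axiom_Comega.intros)+
  ultimately show "entails \<Gamma> \<alpha> \<gamma> \<and> entails \<Gamma> \<beta> \<gamma>"
    using entails_trans by blast
next
  assume "entails \<Gamma> \<alpha> \<gamma> \<and> entails \<Gamma> \<beta> \<gamma>"
  then show "entails \<Gamma> (\<alpha> \<^bold>\<or> \<beta>) \<gamma>"
    unfolding entails_def using mp ax[OF axiom_Comega.intros(8)] by blast
qed

text \<open>For the converse, instantiate \<delta> with \<alpha> \<and> \<gamma>, then discharge
  \<alpha> and \<gamma> by the deduction theorem.\<close>

lemma entails_Imp:
  "entails \<Gamma> \<gamma> (\<alpha> \<^bold>\<rightarrow> \<beta>) \<longleftrightarrow> (\<forall>\<delta>. entails \<Gamma> \<delta> \<alpha> \<longrightarrow> entails \<Gamma> \<delta> \<gamma> \<longrightarrow> entails \<Gamma> \<delta> \<beta>)"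
proof
  assume "entails \<Gamma> \<gamma> (\<alpha> \<^bold>\<rightarrow> \<beta>)"
  then have "entails \<Gamma> \<delta> (\<alpha> \<^bold>\<rightarrow> \<beta>)" if "entails \<Gamma> \<delta> \<gamma>" for \<delta>
    using that entails_trans by blast
  then show "\<forall>\<delta>. entails \<Gamma> \<delta> \<alpha> \<longrightarrow> entails \<Gamma> \<delta> \<gamma> \<longrightarrow> entails \<Gamma> \<delta> \<beta>"
    unfolding entails_def using deriv_imp_mp by blast
next
  assume "\<forall>\<delta>. entails \<Gamma> \<delta> \<alpha> \<longrightarrow> entails \<Gamma> \<delta> \<gamma> \<longrightarrow> entails \<Gamma> \<delta> \<beta>"
  then have "entails \<Gamma> (\<alpha> \<^bold>\<and> \<gamma>) \<beta>"
    using entails_And entails_refl by blast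
  then have "insert \<alpha> (insert \<gamma> \<Gamma>) \<turnstile>\<^sub>C\<^sub>\<omega> (\<alpha> \<^bold>\<and> \<gamma>) \<^bold>\<rightarrow> \<beta>"
    unfolding entails_def by (rule deriv_mono) blast
  moreover have "insert \<alpha> (insert \<gamma> \<Gamma>) \<turnstile>\<^sub>C\<^sub>\<omega> \<alpha> \<^bold>\<and> \<gamma>"
    by (rule mp[OF hyp mp[OF hyp ax[OF axiom_Comega.intros(3)]]]) simp_all
  ultimately have "insert \<alpha> (insert \<gamma> \<Gamma>) \<turnstile>\<^sub>C\<^sub>\<omega> \<beta>"
    by (rule mp[rotated])
  then show "entails \<Gamma> \<gamma> (\<alpha> \<^bold>\<rightarrow> \<beta>)"
    unfolding entails_def by (simp add: deduction)
qed

text \<open>Taking the derivable \<phi> \<rightarrow> \<phi> for \<gamma> gives one direction,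
  weakening the other. Hence the top formulas are the consequences of \<Gamma>.\<close>

lemma all_entails_iff: "(\<forall>\<gamma>. entails \<Gamma> \<gamma> \<phi>) \<longleftrightarrow> \<Gamma> \<turnstile>\<^sub>C\<^sub>\<omega> \<phi>"
proof
  assume "\<forall>\<gamma>. entails \<Gamma> \<gamma> \<phi>"
  then have "\<Gamma> \<turnstile>\<^sub>C\<^sub>\<omega> (\<phi> \<^bold>\<rightarrow> \<phi>) \<^bold>\<rightarrow> \<phi>"
    by (simp add: entails_def)
  then show "\<Gamma> \<turnstile>\<^sub>C\<^sub>\<omega> \<phi>"
    by (rule mp[OF deriv_self_imp])
next
  assume "\<Gamma> \<turnstile>\<^sub>C\<^sub>\<omega> \<phi>"
  then show "\<forall>\<gamma>. entails \<Gamma> \<gamma> \<phi>"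
    by (simp add: entails_def deriv_weaken)
qed

text \<open>The algebra lives on the image of the formulas under an injection \<open>f\<close>, because the type of
  the elements is prescribed.\<close>

locale lindenbaum =
  fixes \<Gamma> :: "fm set" and f :: "fm \<Rightarrow> 'a"
  assumes inj: "inj f"
begin

definition lind_le :: "'a \<Rightarrow> 'a \<Rightarrow> bool" where
  "lind_le x y \<longleftrightarrow> entails \<Gamma> (inv f x) (inv f y)"

text \<open>Each hyperoperation collects all elements with the universal property, so the membership
  premises of \<open>IHLI\<close> hold by definition and only non-emptiness is left. Negation is
  added separately because swap structures are built over the positive part.\<close>

definition lind_pos :: "'a pos_hyperalgebra" where
  "lind_pos =
    \<lparr> carrier = range f,
      hmeet = (\<lambda>x y. {m \<in> range f. \<forall>c\<in>range f. lind_le c m \<longleftrightarrow> lind_le c x \<and> lind_le c y}),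
      hjoin = (\<lambda>x y. {j \<in> range f. \<forall>c\<in>range f. lind_le j c \<longleftrightarrow> lind_le x c \<and> lind_le y c}),
      himp = (\<lambda>x y. {z \<in> range f. \<forall>c\<in>range f. lind_le c z \<longleftrightarrow>
        (\<forall>d\<in>range f. lind_le d x \<longrightarrow> lind_le d c \<longrightarrow> lind_le d y)}) \<rparr>"

definition lind :: "'a hyperalgebra" where
  "lind = pos_hyperalgebra.extend lind_pos \<lparr> hneg = (\<lambda>x. {f (\<^bold>\<not> inv f x)}) \<rparr>"

lemma lind_le_f [simp]: "lind_le (f \<alpha>) (f \<beta>) \<longleftrightarrow> entails \<Gamma> \<alpha> \<beta>"
  by (simp add: lind_le_def inj)

lemma proset_lind: "proset (range f) lind_le"
proof
  show "reflp_on (range f) lind_le"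
    by (auto intro!: reflp_onI entails_refl)
  show "transp_on (range f) lind_le"
    by (rule transp_onI) (auto intro: entails_trans)
qed simp

lemma lind_tops: "f \<phi> \<in> proset.tops (range f) lind_le \<longleftrightarrow> \<Gamma> \<turnstile>\<^sub>C\<^sub>\<omega> \<phi>"
  by (simp add: proset.mem_tops[OF proset_lind] all_entails_iff)

lemma connectives_lind_pos:
  "f (\<alpha> \<^bold>\<and> \<beta>) \<in> hmeet lind_pos (f \<alpha>) (f \<beta>)"
  "f (\<alpha> \<^bold>\<or> \<beta>) \<in> hjoin lind_pos (f \<alpha>) (f \<beta>)"
  "f (\<alpha> \<^bold>\<rightarrow> \<beta>) \<in> himp lind_pos (f \<alpha>) (f \<beta>)"
  by (auto simp: lind_pos_def entails_And entails_Or entails_Imp)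

lemma carrier_lind_pos: "carrier lind_pos = range f"
  by (simp add: lind_pos_def)

lemma IHL_lind_pos: "IHL lind_pos lind_le"
proof (rule IHLI, unfold carrier_lind_pos)
  show "proset (range f) lind_le"
    by (rule proset_lind)
  fix x y
  assume "x \<in> range f" "y \<in> range f"
  then show "\<exists>u. u \<in> hmeet lind_pos x y" "\<exists>u. u \<in> hjoin lind_pos x y" "\<exists>u. u \<in> himp lind_pos x y"
    using connectives_lind_pos by blast+
qed (simp_all add: lind_pos_def)

lemma lind_simps [simp]:
  "carrier lind = range f" "hmeet lind = hmeet lind_pos" "hjoin lind = hjoin lind_pos"
  "himp lind = himp lind_pos" "hneg lind = (\<lambda>x. {f (\<^bold>\<not> inv f x)})"
  by (simp_all add: lind_def lind_pos_def pos_hyperalgebra.extend_def)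

text \<open>A member of the join lies above both arguments, hence is entailed by the axiom \<alpha>
  \<or> \<not>\<alpha>. This gives excluded middle in \<open>lind\<close> and places the pairs of
  the canonical valuation in the swap domain.\<close>

lemma hjoin_lind_pos_Neg: "hjoin lind_pos (f \<alpha>) (f (\<^bold>\<not> \<alpha>)) \<subseteq> proset.tops (range f) lind_le"
proof
  fix w
  assume w: "w \<in> hjoin lind_pos (f \<alpha>) (f (\<^bold>\<not> \<alpha>))"
  then obtain \<beta> where \<beta>: "w = f \<beta>"
    by (auto simp: lind_pos_def)
  have "entails \<Gamma> (\<alpha> \<^bold>\<or> \<^bold>\<not> \<alpha>) \<beta>"
    unfolding entails_Or using w entails_refl[of \<Gamma> \<beta>] by (simp add: \<beta> lind_pos_def)
  moreover have "\<Gamma> \<turnstile>\<^sub>C\<^sub>\<omega> \<alpha> \<^bold>\<or> \<^bold>\<not> \<alpha>"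
    by (intro ax axiom_Comega.intros)
  ultimately have "\<Gamma> \<turnstile>\<^sub>C\<^sub>\<omega> \<beta>"
    unfolding entails_def by (rule mp[rotated])
  then show "w \<in> proset.tops (range f) lind_le"
    by (simp add: \<beta> lind_tops)
qed

lemma entails_double_Neg: "entails \<Gamma> (\<^bold>\<not> (\<^bold>\<not> \<alpha>)) \<alpha>"
  by (intro entails_axiom axiom_Comega.intros)

lemma HComegaA_lind: "HComegaA lind lind_le"
proof -
  interpret pos: IHL lind_pos lind_le
    by (rule IHL_lind_pos)
  \<comment> \<open>\<open>lind\<close> has a different record type from \<open>lind_pos\<close>, so
    the universal properties are passed through \<open>IHLI\<close> once more.\<close>
  have "IHL lind lind_le"
    by (rule IHLI)
      (use pos.proset_axioms pos.mem_hmeet pos.mem_hjoin pos.mem_himp pos.ex_hmeet pos.ex_hjoin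
        pos.ex_himp in \<open>simp_all add: carrier_lind_pos\<close>)
  then interpret IHL lind lind_le .
  show ?thesis
  proof
    show "hyperop1 (carrier lind) (hneg lind)"
      by (auto simp: hyperop1_def)
    show "w \<in> tops" if "x \<in> carrier lind" "y \<in> hneg lind x" "w \<in> hjoin lind x y" for x y w
      using that by (auto simp: inj dest: subsetD[OF hjoin_lind_pos_Neg])
    show "lind_le w x" if "x \<in> carrier lind" "y \<in> hneg lind x" "w \<in> hneg lind y" for x y w
      using that by (auto simp: inj entails_double_Neg)
  qed
qed

lemma valuation_lind: "valuation lind f"
  by (simp add: valuation_def connectives_lind_pos inj)

text \<open>In the negation clause the first components agree by construction, and the inequality of
  second components is the axiom \<not>\<not>\<alpha> \<rightarrow> \<alpha>.\<close>

lemma valuation_swap_lind: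
  "valuation (IHL.swap_structure lind_pos lind_le) (\<lambda>\<alpha>. (f \<alpha>, f (\<^bold>\<not> \<alpha>)))"
proof -
  interpret IHL lind_pos lind_le
    by (rule IHL_lind_pos)
  have "(f \<alpha>, f (\<^bold>\<not> \<alpha>)) \<in> swap_dom (hjoin lind_pos)" for \<alpha>
    unfolding mem_swap_dom_hjoin using hjoin_lind_pos_Neg by (simp add: carrier_lind_pos)
  then show ?thesis
    by (simp add: valuation_def swap_structure_def connectives_lind_pos entails_double_Neg)
qed

lemma swap_lind_designated:
  "(f \<alpha>, f (\<^bold>\<not> \<alpha>)) \<in> IHL.swap_designated lind_pos lind_le \<longleftrightarrow> \<Gamma> \<turnstile>\<^sub>C\<^sub>\<omega> \<alpha>"
proof -
  interpret IHL lind_pos lind_le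
    by (rule IHL_lind_pos)
  have "(f \<alpha>, f (\<^bold>\<not> \<alpha>)) \<in> swap_dom (hjoin lind_pos)"
    using valuation_swap_lind by (auto simp: valuation_def swap_structure_def)
  then show ?thesis
    using lind_tops by (simp add: swap_designated_def carrier_lind_pos)
qed

end

section \<open>Transfer to arbitrary infinite types and the equivalence\<close>

instance fm :: countable
  by countable_datatype

lemma ex_inj_fm:
  assumes "infinite (UNIV :: 'a set)"
  shows "\<exists>f :: fm \<Rightarrow> 'a. inj f"
proof -
  obtain g :: "nat \<Rightarrow> 'a" where "inj g"
    using infinite_countable_subset[OF assms] by blast
  then have "inj (g \<circ> to_nat :: fm \<Rightarrow> 'a)"
    by (intro inj_compose) auto
  then show ?thesis
    by blast
qed

lemma HComega_conseq_sound: "\<Gamma> \<turnstile>\<^sub>C\<^sub>\<omega> \<phi> \<Longrightarrow> HComega_conseq TYPE('a) \<Gamma> \<phi>"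
  by (simp add: HComega_conseq_def HComegaA.deriv_Comega_sound)

lemma HSW_conseq_sound: "\<Gamma> \<turnstile>\<^sub>C\<^sub>\<omega> \<phi> \<Longrightarrow> HSW_conseq TYPE('a) \<Gamma> \<phi>"
  unfolding HSW_conseq_def
  by (auto simp: IHL.swap_nmatrix_def IHL.swap_designated_eq_tops
      intro: HComegaA.deriv_Comega_sound IHL.swap_structure_HComegaA)

lemma HComega_conseq_complete:
  assumes "infinite (UNIV :: 'a set)" and conseq: "HComega_conseq TYPE('a) \<Gamma> \<phi>"
  shows "\<Gamma> \<turnstile>\<^sub>C\<^sub>\<omega> \<phi>"
proof -
  obtain f :: "fm \<Rightarrow> 'a" where "inj f"
    using ex_inj_fm assms(1) by blast
  then interpret lindenbaum \<Gamma> f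
    by unfold_locales
  have "nmatrix_conseq (lind, proset.tops (range f) lind_le) \<Gamma> \<phi>"
    using conseq HComegaA_lind unfolding HComega_conseq_def by fastforce
  then show ?thesis
    \<comment> \<open>Under the valuation \<open>f\<close> every member of \<Gamma> is top, so
      \<phi> is top as well, which means derivable.\<close>
    using valuation_lind lind_tops by (auto simp: nmatrix_conseq_def intro: hyp)
qed

lemma HSW_conseq_complete:
  assumes "infinite (UNIV :: 'a set)" and conseq: "HSW_conseq TYPE('a) \<Gamma> \<phi>"
  shows "\<Gamma> \<turnstile>\<^sub>C\<^sub>\<omega> \<phi>"
proof -
  obtain f :: "fm \<Rightarrow> 'a" where "inj f"
    using ex_inj_fm assms(1) by blast
  then interpret lindenbaum \<Gamma> f
    by unfold_locales
  have "nmatrix_conseq (IHL.swap_nmatrix lind_pos lind_le) \<Gamma> \<phi>"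
    using conseq IHL_lind_pos unfolding HSW_conseq_def by blast
  then have "\<forall>\<gamma>\<in>\<Gamma>. (f \<gamma>, f (\<^bold>\<not> \<gamma>)) \<in> IHL.swap_designated lind_pos lind_le \<Longrightarrow>
      (f \<phi>, f (\<^bold>\<not> \<phi>)) \<in> IHL.swap_designated lind_pos lind_le"
    using valuation_swap_lind
    by (auto simp: nmatrix_conseq_def IHL.swap_nmatrix_def[OF IHL_lind_pos])
  then show ?thesis
    unfolding swap_lind_designated by (blast intro: hyp)
qed

text \<open>Each consequence relation is compared with derivability separately, so the two types may
  be chosen independently. Infinity serves to embed the formulas, for completeness; soundness holds
  over every type.\<close>

theorem theorem4p8:
  fixes \<Gamma> :: "fm set" and \<phi> :: fm
  assumes "infinite (UNIV :: 'a set)" and "infinite (UNIV :: 'b set)"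
  shows "(\<Gamma> \<turnstile>\<^sub>C\<^sub>\<omega> \<phi> \<longleftrightarrow> HComega_conseq TYPE('a) \<Gamma> \<phi>) \<and>
         (HComega_conseq TYPE('a) \<Gamma> \<phi> \<longleftrightarrow> HSW_conseq TYPE('b) \<Gamma> \<phi>)"
  using HComega_conseq_sound HSW_conseq_sound HComega_conseq_complete[OF assms(1)]
    HSW_conseq_complete[OF assms(2)] by blast

end
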